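(* The binary tree $T^4_2$ of height 4 has a fractional pebbling using $8/3$ pebbles when white sliding moves are allowed.
   Context: $T^4_2$ is the balanced rooted binary tree with 4 levels (15 nodes). A fractional configuration assigns to each node $i$ reals $b(i),w(i)\ge 0$ with $b(i)+w(i)\le1$; the number of pebbles is $\sum_i(b(i)+w(i))$. Moves: (i) decrease any $b(i)$; (ii) increase any $w(i)$; (iii) if both children of $i$ have $b+w=1$ (vacuous for leaves), set $w(i)=0$, increase $b(i)$ arbitrarily, and simultaneously decrease black values of the children arbitrarily; and, with white sliding moves allowed, (iv) for an internal node $i$ with $w(i)=1$ and a child $j$ such that every other child of $i$ has pebble value $1$, decrease $w(i)$ to $0$ and increase $w(j)$ so that $j$ has pebble value $1$. A fractional pebbling using $p$ pebbles starts and ends with all values $0$, has the root with black value $1$ at some point, and never exceeds $p$ pebbles. *)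

theory Defs imports Complex_Main begin

text \<open>
  The balanced binary tree with \<open>h\<close> levels in heap numbering: the root is node 1 and the
  children of an internal node \<open>i\<close> are \<open>2 * i\<close> and \<open>2 * i + 1\<close>.
\<close>

definition nodes :: "nat \<Rightarrow> nat set" where
  "nodes h = {1..<2 ^ h}"

definition children :: "nat \<Rightarrow> nat \<Rightarrow> nat set" where
  "children h i = {2 * i, 2 * i + 1} \<inter> nodes h"

text \<open>A configuration is a pair \<open>(b, w)\<close> of black and white pebble values.\<close>

type_synonym config = "(nat \<Rightarrow> real) \<times> (nat \<Rightarrow> real)"

text \<open>Numbers that are not nodes carry the dummy value 0.\<close>

definition fractional_config :: "nat \<Rightarrow> config \<Rightarrow> bool" where
  "fractional_config h = (\<lambda>(b, w).
     (\<forall>i\<in>nodes h. 0 \<le> b i \<and> 0 \<le> w i \<and> b i + w i \<le> 1) \<and>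
     (\<forall>i. i \<notin> nodes h \<longrightarrow> b i = 0 \<and> w i = 0))"

definition num_pebbles :: "nat \<Rightarrow> config \<Rightarrow> real" where
  "num_pebbles h = (\<lambda>(b, w). \<Sum>i\<in>nodes h. b i + w i)"

text \<open>
  The move relations describe only the change of values; that both sides are legal
  configurations is required separately in \<open>fractional_pebbling\<close>. Increasing and decreasing
  are meant non-strictly.
\<close>

inductive fractional_move :: "nat \<Rightarrow> config \<Rightarrow> config \<Rightarrow> bool" for h where
  decrease_black:
    "\<lbrakk>i \<in> nodes h; x \<le> b i\<rbrakk> \<Longrightarrow> fractional_move h (b, w) (b(i := x), w)"
| increase_white:
    "\<lbrakk>i \<in> nodes h; w i \<le> x\<rbrakk> \<Longrightarrow> fractional_move h (b, w) (b, w(i := x))"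
| place_black:
    "\<lbrakk>i \<in> nodes h; \<forall>j\<in>children h i. b j + w j = 1;
      b i \<le> b' i; \<forall>j\<in>children h i. b' j \<le> b j;
      \<forall>k. k \<notin> insert i (children h i) \<longrightarrow> b' k = b k\<rbrakk>
     \<Longrightarrow> fractional_move h (b, w) (b', w(i := 0))"

text \<open>
  In a legal configuration \<open>1 - b j \<ge> w j\<close>, so the new white value of \<open>j\<close> is indeed an increase,
  and it is the one that gives \<open>j\<close> pebble value 1.
\<close>

inductive white_sliding_move :: "nat \<Rightarrow> config \<Rightarrow> config \<Rightarrow> bool" for h where
  "\<lbrakk>i \<in> nodes h; w i = 1; j \<in> children h i; \<forall>k\<in>children h i - {j}. b k + w k = 1\<rbrakk>
   \<Longrightarrow> white_sliding_move h (b, w) (b, w(i := 0, j := 1 - b j))"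

definition fractional_pebbling ::
  "(config \<Rightarrow> config \<Rightarrow> bool) \<Rightarrow> nat \<Rightarrow> real \<Rightarrow> config list \<Rightarrow> bool" where
  "fractional_pebbling move h p cs \<longleftrightarrow>
     cs \<noteq> [] \<and>
     hd cs = (\<lambda>_. 0, \<lambda>_. 0) \<and> last cs = (\<lambda>_. 0, \<lambda>_. 0) \<and>
     (\<forall>k. Suc k < length cs \<longrightarrow> move (cs ! k) (cs ! Suc k)) \<and>
     (\<exists>c\<in>set cs. fst c 1 = 1) \<and>
     (\<forall>c\<in>set cs. fractional_config h c \<and> num_pebbles h c \<le> p)"

definition has_fractional_pebbling_white_sliding :: "nat \<Rightarrow> real \<Rightarrow> bool" where
  "has_fractional_pebbling_white_sliding h p \<longleftrightarrow>
     (\<exists>cs. fractional_pebbling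
       (\<lambda>c c'. fractional_move h c c' \<or> white_sliding_move h c c') h p cs)"

end

theory Submission imports Defs begin

text \<open>
  The pebbling is explicit and all its values are multiples of \<open>1/3\<close>, so it is run on
  natural numbers in units of \<open>1/3\<close>, with 8 units available. The right child of the root
  carries only 1 black unit while the left child is filled to black 1, and the left
  child's right child is pebbled with 1 black and 2 white units in the meantime. Once the
  root is black, the white pebbles must go. Placing black pebbles on both children of a node
  of level 3 that holds a full white pebble would take 9 units; sliding the white pebble
  down to a leaf, where it may be removed at once, needs only 6.
\<close>

text \<open>
  The lists of black and white units are indexed by the heap numbers \<open>1, \<dots>, 15\<close>;
  entry 0 is a dummy.
\<close>

type_synonym state = "nat list \<times> nat list"

datatype step = Lower nat nat | Raise nat nat | Place nat nat | Slide nat nat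

fun full :: "state \<Rightarrow> nat \<Rightarrow> bool" where
  "full (bs, ws) j \<longleftrightarrow> j < 16 \<longrightarrow> bs ! j + ws ! j = 3"

fun legal :: "state \<Rightarrow> bool" where
  "legal (bs, ws) \<longleftrightarrow> length bs = 16 \<and> length ws = 16 \<and>
     (\<forall>i\<in>{1..<16}. bs ! i + ws ! i \<le> 3) \<and> (\<Sum>i\<in>{1..<16}. bs ! i + ws ! i) \<le> 8"

text \<open>Updates and fullness beyond index 15 are void, so a leaf can always be placed.\<close>

fun perform :: "step \<Rightarrow> state \<Rightarrow> state" where
  "perform (Lower i x) (bs, ws) = (bs[i := x], ws)"
| "perform (Raise i x) (bs, ws) = (bs, ws[i := x])"
| "perform (Place i x) (bs, ws) = (bs[i := x, 2 * i := 0, 2 * i + 1 := 0], ws[i := 0])"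
| "perform (Slide i j) (bs, ws) = (bs, ws[i := 0, j := 3 - bs ! j])"

fun enabled :: "step \<Rightarrow> state \<Rightarrow> bool" where
  "enabled (Lower i x) (bs, ws) \<longleftrightarrow> 1 \<le> i \<and> i < 16 \<and> x \<le> bs ! i"
| "enabled (Raise i x) (bs, ws) \<longleftrightarrow> 1 \<le> i \<and> i < 16 \<and> ws ! i \<le> x"
| "enabled (Place i x) (bs, ws) \<longleftrightarrow> 1 \<le> i \<and> i < 16 \<and> bs ! i \<le> x \<and>
     full (bs, ws) (2 * i) \<and> full (bs, ws) (2 * i + 1)"
| "enabled (Slide i j) (bs, ws) \<longleftrightarrow> 1 \<le> i \<and> j < 16 \<and> ws ! i = 3 \<and>
     (j = 2 * i \<and> full (bs, ws) (2 * i + 1) \<or> j = 2 * i + 1 \<and> full (bs, ws) (2 * i))"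

fun trace :: "state \<Rightarrow> step list \<Rightarrow> state list" where
  "trace s [] = [s]"
| "trace s (m # ms) = s # trace (perform m s) ms"

fun valid :: "state \<Rightarrow> step list \<Rightarrow> bool" where
  "valid s [] \<longleftrightarrow> legal s"
| "valid s (m # ms) \<longleftrightarrow> legal s \<and> enabled m s \<and> valid (perform m s) ms"

text \<open>Non-nodes get 0, as \<open>fractional_config\<close> demands; this also hides the dummy
  entry and indices beyond the list.\<close>

definition thirds :: "nat list \<Rightarrow> nat \<Rightarrow> real" where
  "thirds xs i = (if i \<in> {1..<16} then real (xs ! i) / 3 else 0)"

fun config_of :: "state \<Rightarrow> config" where
  "config_of (bs, ws) = (thirds bs, thirds ws)"

lemma nodes_4: "nodes 4 = {1..<16}"
  by (simp add: nodes_def)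

lemma thirds_update:
  "i \<in> {1..<16} \<Longrightarrow> length xs = 16 \<Longrightarrow> thirds (xs[i := x]) = (thirds xs)(i := x / 3)"
  by (auto simp: thirds_def fun_eq_iff nth_list_update)

lemma legal_config_of:
  assumes "legal s"
  shows "fractional_config 4 (config_of s)" and "num_pebbles 4 (config_of s) \<le> 8 / 3"
proof -
  obtain bs ws where s: "s = (bs, ws)"
    by (cases s)
  have le: "bs ! i + ws ! i \<le> 3" if "i \<in> {1..<16}" for i
    using assms that by (simp add: s)
  have "real (bs ! i) + real (ws ! i) \<le> 3" if "i \<in> {1..<16}" for i
    using le[OF that] by linarith
  then show "fractional_config 4 (config_of s)"
    by (auto simp: s fractional_config_def nodes_4 thirds_def add_divide_distrib[symmetric])
  have "num_pebbles 4 (config_of s) = (\<Sum>i\<in>{1..<16}. real (bs ! i + ws ! i) / 3)"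
    unfolding num_pebbles_def s nodes_4
    by (auto simp: thirds_def add_divide_distrib intro!: sum.cong)
  also have "\<dots> = real (\<Sum>i\<in>{1..<16}. bs ! i + ws ! i) / 3"
    by (simp only: of_nat_sum sum_divide_distrib)
  also have "\<dots> \<le> 8 / 3"
    using assms unfolding s legal.simps by linarith
  finally show "num_pebbles 4 (config_of s) \<le> 8 / 3" .
qed

lemma full_thirds:
  assumes "full (bs, ws) j" and "j \<in> {1..<16}"
  shows "thirds bs j + thirds ws j = 1"
proof -
  have "real (bs ! j) + real (ws ! j) = 3"
    using assms by (auto simp flip: of_nat_add)
  then show ?thesis
    using assms(2) by (simp add: thirds_def add_divide_distrib[symmetric])
qed

text \<open>Each kind of step is an instance of one move rule; \<open>Place\<close> is the case
  where the children lose all their black and keep their white.\<close>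

lemma perform_move:
  assumes "legal s" and "enabled m s"
  shows "fractional_move 4 (config_of s) (config_of (perform m s)) \<or>
    white_sliding_move 4 (config_of s) (config_of (perform m s))"
proof -
  obtain bs ws where s: "s = (bs, ws)"
    by (cases s)
  have len: "length bs = 16" "length ws = 16"
    and le: "\<And>i. i \<in> {1..<16} \<Longrightarrow> bs ! i + ws ! i \<le> 3"
    using assms(1) by (auto simp: s)
  show ?thesis
  proof (cases m)
    case (Lower i x)
    then have "i \<in> nodes 4" and "real x / 3 \<le> thirds bs i"
      using assms(2) by (auto simp: s nodes_4 thirds_def)
    from decrease_black[of i 4 "real x / 3" "thirds bs" "thirds ws", OF this] show ?thesis
      using Lower assms(2) by (simp add: s thirds_update len)
  next
    case (Raise i x)
    then have "i \<in> nodes 4" and "thirds ws i \<le> real x / 3"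
      using assms(2) by (auto simp: s nodes_4 thirds_def)
    from increase_white[of i 4 "thirds ws" "real x / 3" "thirds bs", OF this] show ?thesis
      using Raise assms(2) by (simp add: s thirds_update len)
  next
    case (Place i x)
    let ?bs = "bs[i := x, 2 * i := 0, 2 * i + 1 := 0]"
    have i: "i \<in> {1..<16}"
      using Place assms(2) by (simp add: s)
    have "fractional_move 4 (thirds bs, thirds ws) (thirds ?bs, (thirds ws)(i := 0))"
    proof (rule place_black)
      show "i \<in> nodes 4"
        using i by (simp add: nodes_4)
      show "\<forall>j\<in>children 4 i. thirds bs j + thirds ws j = 1"
        using Place assms(2)
        by (auto simp: s children_def nodes_4 intro!: full_thirds simp del: full.simps)
      \<comment> \<open>Since \<open>i \<ge> 1\<close>, both \<open>2 * i\<close> and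
        \<open>2 * i + 1\<close> differ from \<open>i\<close>, so the zeroing does not overwrite
        \<open>x\<close>.\<close>
      show "thirds bs i \<le> thirds ?bs i"
        using Place assms(2) by (auto simp: s thirds_def nth_list_update len)
      show "\<forall>j\<in>children 4 i. thirds ?bs j \<le> thirds bs j"
        using i by (auto simp: children_def nodes_4 thirds_def nth_list_update len)
      show "\<forall>k. k \<notin> insert i (children 4 i) \<longrightarrow> thirds ?bs k = thirds bs k"
        by (auto simp: children_def nodes_4 thirds_def nth_list_update len)
    qed
    then show ?thesis
      using Place thirds_update[OF i len(2), of 0] by (simp add: s)
  next
    case (Slide i j)
    have ij: "i \<in> {1..<16}" "j \<in> {1..<16}"
      using Slide assms(2) by (auto simp: s)
    have move: "white_sliding_move 4 (thirds bs, thirds ws)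
      (thirds bs, (thirds ws)(i := 0, j := 1 - thirds bs j))"
    proof (rule white_sliding_move.intros)
      show "i \<in> nodes 4"
        using ij by (simp add: nodes_4)
      show "thirds ws i = 1"
        using Slide assms(2) ij by (auto simp: s thirds_def)
      show "j \<in> children 4 i"
        using Slide assms(2) ij by (auto simp: s children_def nodes_4)
      show "\<forall>k\<in>children 4 i - {j}. thirds bs k + thirds ws k = 1"
        using Slide assms(2)
        by (auto simp: s children_def nodes_4 intro!: full_thirds simp del: full.simps)
    qed
    \<comment> \<open>Legality gives \<open>bs ! j \<le> 3\<close>, so the subtraction on naturals
      is not truncated.\<close>
    have eq: "1 - thirds bs j = real (3 - bs ! j) / 3"
      using le[OF ij(2)] ij by (simp add: thirds_def of_nat_diff field_simps)
    show ?thesis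
      using Slide ij move[unfolded eq] by (simp add: s thirds_update len)
  qed
qed

lemma trace_neq_Nil [simp]: "trace s ms \<noteq> []"
  by (cases ms) auto

lemma trace_nth_0 [simp]: "trace s ms ! 0 = s"
  by (cases ms) auto

lemma valid_legal: "valid s ms \<Longrightarrow> t \<in> set (trace s ms) \<Longrightarrow> legal t"
  by (induction s ms rule: trace.induct) auto

lemma valid_move:
  "\<lbrakk>valid s ms; Suc k < length (trace s ms)\<rbrakk> \<Longrightarrow>
    fractional_move 4 (config_of (trace s ms ! k)) (config_of (trace s ms ! Suc k)) \<or>
    white_sliding_move 4 (config_of (trace s ms ! k)) (config_of (trace s ms ! Suc k))"
proof (induction s ms arbitrary: k rule: trace.induct)
  case (2 s m ms)
  then show ?case
    using perform_move[of s m] by (cases k) auto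
qed simp

definition empty_state :: state where
  "empty_state = (replicate 16 0, replicate 16 0)"

lemma config_of_empty_state: "config_of empty_state = (\<lambda>_. 0, \<lambda>_. 0)"
  by (auto simp: empty_state_def thirds_def fun_eq_iff)

text \<open>Reduces the theorem to conditions on natural numbers that evaluation decides.\<close>

lemma fractional_pebbling_trace:
  assumes "valid empty_state ms" and "last (trace empty_state ms) = empty_state"
    and "\<exists>s\<in>set (trace empty_state ms). fst s ! 1 = 3"
  shows "has_fractional_pebbling_white_sliding 4 (8 / 3)"
proof -
  let ?cs = "map config_of (trace empty_state ms)"
  obtain bs ws where "(bs, ws) \<in> set (trace empty_state ms)" and "bs ! 1 = 3"
    using assms(3) by auto
  then have "\<exists>c\<in>set ?cs. fst c 1 = 1"
    by (auto simp: thirds_def intro!: bexI[of _ "(bs, ws)"])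
  then have "fractional_pebbling
      (\<lambda>c c'. fractional_move 4 c c' \<or> white_sliding_move 4 c c') 4 (8 / 3) ?cs"
    using valid_move[OF assms(1)] legal_config_of[OF valid_legal[OF assms(1)]] assms(2)
    by (auto simp: fractional_pebbling_def hd_map last_map hd_conv_nth config_of_empty_state)
  then show ?thesis
    unfolding has_fractional_pebbling_white_sliding_def by blast
qed

text \<open>
  For nodes \<open>i\<close> of level 3, whose children are leaves. With \<open>x\<close> the present number of black
  units of \<open>i\<close>, \<open>place_via_leaves i x\<close> just removes the white ones.
\<close>

definition place_via_leaves :: "nat \<Rightarrow> nat \<Rightarrow> step list" where
  "place_via_leaves i x = [Place (2 * i) 3, Place (2 * i + 1) 3, Place i x]"

definition slide_via_leaves :: "nat \<Rightarrow> step list" where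
  "slide_via_leaves i =
     [Place (2 * i) 3, Slide i (2 * i + 1), Place (2 * i + 1) 0, Lower (2 * i) 0]"

text \<open>Nodes 7 and 5 first get 2 and 1 black units, all that fits beside the 6 units on the
  leaves of their siblings and, for node 5, the black unit on node 3. Once the root is cleared,
  nodes 3 and 5 hold 2 white units each. Sliding needs 3, so each is topped up just before its turn;
  clearing node 5 first takes 6 + 2 = 8 units.\<close>

definition strategy :: "step list" where
  "strategy =
     place_via_leaves 7 2 @ place_via_leaves 6 3 @ [Raise 7 1, Place 3 1] @
     place_via_leaves 7 0 @ place_via_leaves 5 1 @ place_via_leaves 4 3 @
     [Raise 5 2, Raise 3 1, Place 2 3, Raise 3 2, Place 1 3, Lower 1 0, Raise 5 3] @
     slide_via_leaves 5 @ place_via_leaves 6 3 @ [Raise 3 3, Slide 3 7, Place 3 0] @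
     slide_via_leaves 7"

theorem theorem4p12:
  "has_fractional_pebbling_white_sliding 4 (8 / 3)"
proof (rule fractional_pebbling_trace)
  show "valid empty_state strategy"
    by code_simp
  show "last (trace empty_state strategy) = empty_state"
    by code_simp
  show "\<exists>s\<in>set (trace empty_state strategy). fst s ! 1 = 3"
    by code_simp
qed

end
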